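(* Let $R$ be a unital semiprime left Goldie ring, let $X$ be any nonempty set of noncommuting variables, and for each $x\in X$ let $\sigma_x$ be a ring automorphism of $R$ and $\delta_x$ a $\sigma_x$-derivation of $R$. Put $\mathscr{G}=\{\sigma_x\}_{x\in X}$ and $\mathscr{D}=\{\delta_x\}_{x\in X}$. Then the free skew extension $R[X;\mathscr{G},\mathscr{D}]$ is semiprimitive, i.e. its Jacobson radical is zero.
   Context: For a ring endomorphism $\sigma$ of $R$, a $\sigma$-derivation is an additive map $\delta\colon R\to R$ with $\delta(ab)=\delta(a)b+\sigma(a)\delta(b)$ for all $a,b\in R$. The maps $x\mapsto\sigma_x$, $x\mapsto\delta_x$ need not be injective. Let $\langle X\rangle$ be the free monoid on $X$. A free skew extension $S=R[X;\mathscr{G},\mathscr{D}]$ is a ring $S$ such that: $S$ contains $R$ as a (unital) subring; $X\subseteq S$; $S$ is a free left $R$-module with basis $\langle X\rangle$ (the monoid of products of elements of $X$ in $S$, identified with the free monoid); and $xr=\sigma_x(r)x+\delta_x(r)$ for all $x\in X$, $r\in R$. A ring is left Goldie if it has no infinite direct sum of nonzero left ideals and satisfies the ascending chain condition on left annihilators. *)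

theory Defs
  imports Main
begin

definition left_ideal :: "'a::ring_1 set \<Rightarrow> bool" where
  "left_ideal I \<longleftrightarrow> 0 \<in> I \<and> (\<forall>a\<in>I. \<forall>b\<in>I. a + b \<in> I) \<and> (\<forall>a\<in>I. - a \<in> I)
     \<and> (\<forall>r. \<forall>a\<in>I. r * a \<in> I)"

definition two_sided_ideal :: "'a::ring_1 set \<Rightarrow> bool" where
  "two_sided_ideal I \<longleftrightarrow> left_ideal I \<and> (\<forall>r. \<forall>a\<in>I. a * r \<in> I)"

text \<open>An ideal I is nilpotent if I^n = 0 for some n \<ge> 1, i.e. every product of n elements
  of I vanishes (I^n is the additive span of such products).\<close>
definition nilpotent_ideal :: "'a::ring_1 set \<Rightarrow> bool" where
  "nilpotent_ideal I \<longleftrightarrow> (\<exists>n\<ge>1. \<forall>xs. length xs = n \<and> set xs \<subseteq> I \<longrightarrow> prod_list xs = 0)"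

definition semiprime_ring :: "'a::ring_1 itself \<Rightarrow> bool" where
  "semiprime_ring _ \<longleftrightarrow>
     (\<forall>I::'a set. two_sided_ideal I \<and> nilpotent_ideal I \<longrightarrow> I = {0})"

definition left_annihilator :: "'a::ring_1 set \<Rightarrow> 'a set" where
  "left_annihilator T = {r. \<forall>t\<in>T. r * t = 0}"

definition has_infinite_direct_sum_left_ideals :: "'a::ring_1 itself \<Rightarrow> bool" where
  "has_infinite_direct_sum_left_ideals _ \<longleftrightarrow>
     (\<exists>L::nat \<Rightarrow> 'a set. (\<forall>i. left_ideal (L i) \<and> L i \<noteq> {0}) \<and>
        (\<forall>n a. (\<forall>i<n. a i \<in> L i) \<and> (\<Sum>i<n. a i) = 0 \<longrightarrow> (\<forall>i<n. a i = 0)))"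

definition acc_left_annihilators :: "'a::ring_1 itself \<Rightarrow> bool" where
  "acc_left_annihilators _ \<longleftrightarrow>
     \<not> (\<exists>f::nat \<Rightarrow> 'a set. (\<forall>n. \<exists>T. f n = left_annihilator T) \<and> (\<forall>n. f n \<subset> f (Suc n)))"

definition left_goldie :: "'a::ring_1 itself \<Rightarrow> bool" where
  "left_goldie R \<longleftrightarrow> \<not> has_infinite_direct_sum_left_ideals R \<and> acc_left_annihilators R"

definition maximal_left_ideal :: "'a::ring_1 set \<Rightarrow> bool" where
  "maximal_left_ideal I \<longleftrightarrow> left_ideal I \<and> I \<noteq> UNIV \<and>
     (\<forall>J. left_ideal J \<and> I \<subseteq> J \<and> J \<noteq> UNIV \<longrightarrow> J = I)"

definition jacobson_radical :: "'a::ring_1 itself \<Rightarrow> 'a set" where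
  "jacobson_radical _ = \<Inter> {I::'a set. maximal_left_ideal I}"

definition semiprimitive :: "'a::ring_1 itself \<Rightarrow> bool" where
  "semiprimitive R \<longleftrightarrow> jacobson_radical R = {0}"

definition ring_hom_1 :: "('a::ring_1 \<Rightarrow> 'b::ring_1) \<Rightarrow> bool" where
  "ring_hom_1 f \<longleftrightarrow> (\<forall>a b. f (a + b) = f a + f b) \<and> (\<forall>a b. f (a * b) = f a * f b) \<and> f 1 = 1"

definition ring_automorphism :: "('a::ring_1 \<Rightarrow> 'a) \<Rightarrow> bool" where
  "ring_automorphism \<sigma> \<longleftrightarrow> ring_hom_1 \<sigma> \<and> bij \<sigma>"

definition sigma_derivation :: "('a::ring_1 \<Rightarrow> 'a) \<Rightarrow> ('a \<Rightarrow> 'a) \<Rightarrow> bool" where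
  "sigma_derivation \<sigma> \<delta> \<longleftrightarrow> (\<forall>a b. \<delta> (a + b) = \<delta> a + \<delta> b) \<and>
     (\<forall>a b. \<delta> (a * b) = \<delta> a * b + \<sigma> a * \<delta> b)"

definition word_elem :: "('x \<Rightarrow> 's::ring_1) \<Rightarrow> 'x list \<Rightarrow> 's" where
  "word_elem var w = prod_list (map var w)"

definition free_skew_extension ::
  "('r::ring_1 \<Rightarrow> 's::ring_1) \<Rightarrow> ('x \<Rightarrow> 's) \<Rightarrow> ('x \<Rightarrow> 'r \<Rightarrow> 'r) \<Rightarrow> ('x \<Rightarrow> 'r \<Rightarrow> 'r) \<Rightarrow> bool" where
  "free_skew_extension \<iota> var \<sigma> \<delta> \<longleftrightarrow>
     ring_hom_1 \<iota> \<and> inj \<iota> \<and>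
     inj (word_elem var) \<and>
     (\<forall>s. \<exists>!c::'x list \<Rightarrow> 'r. finite {w. c w \<noteq> 0} \<and>
          s = (\<Sum>w\<in>{w. c w \<noteq> 0}. \<iota> (c w) * word_elem var w)) \<and>
     (\<forall>x r. var x * \<iota> r = \<iota> (\<sigma> x r) * var x + \<iota> (\<delta> x r))"

end

theory Submission
  imports Defs
begin

text \<open>Let \<open>J\<close> be the Jacobson radical of \<open>S\<close>, suppose \<open>J \<noteq> 0\<close>, and let \<open>L\<^sub>w\<close> be the set of
  coefficients at the word \<open>w\<close> of elements of \<open>J\<close> of degree at most \<open>|w|\<close>. These are two-sided ideals
  of \<open>R\<close> with \<open>L\<^sub>v \<subseteq> L\<^sub>v\<^sub>w\<close> and \<open>\<sigma>\<^sub>v(L\<^sub>w) \<subseteq> L\<^sub>v\<^sub>w\<close>. The chain condition yields a nonempty \<open>w\<close>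
  with \<open>L\<^sub>w \<noteq> 0\<close> such that only \<open>0\<close> in \<open>L\<^sub>v\<^sub>w\<close> annihilates \<open>\<sigma>\<^sub>v(L\<^sub>w)\<close>, for every \<open>v\<close>; Goldie's
  argument yields \<open>c\<close> in \<open>L\<^sub>w\<close> that no nonzero element of \<open>L\<^sub>w\<close> annihilates from the left. Take
  \<open>g \<in> J\<close> with leading coefficient \<open>c\<close> at \<open>w\<close> and \<open>h\<close> with \<open>h (1 + g) = 1\<close>. If \<open>d\<close> is a leading
  coefficient of \<open>h\<close>, at \<open>v\<close>, then \<open>d \<sigma>\<^sub>v(c) = 0\<close>, while \<open>d \<in> L\<^sub>v\<close> if \<open>v\<close> is nonempty because
  \<open>h - 1 \<in> J\<close>. Hence \<open>d\<close> annihilates \<open>\<sigma>\<^sub>v(L\<^sub>w)\<close> and \<open>d = 0\<close>. If \<open>v\<close> is empty, \<open>h = d\<close> is left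
  invertible and \<open>d c = 0\<close>, so \<open>c = 0\<close>.\<close>

section \<open>Semiprime rings with chain conditions\<close>

lemma left_idealD:
  assumes "left_ideal I"
  shows "0 \<in> I" "a \<in> I \<Longrightarrow> b \<in> I \<Longrightarrow> a + b \<in> I" "a \<in> I \<Longrightarrow> - a \<in> I" "a \<in> I \<Longrightarrow> r * a \<in> I"
  using assms by (auto simp: left_ideal_def)

lemma left_ideal_diff: "left_ideal I \<Longrightarrow> a \<in> I \<Longrightarrow> b \<in> I \<Longrightarrow> a - b \<in> I"
  using left_idealD(2)[of I a "- b"] left_idealD(3)[of I b] by simp

lemma left_ideal_one: "left_ideal I \<Longrightarrow> 1 \<in> I \<Longrightarrow> I = UNIV"
  using left_idealD(4)[of I 1] by auto

lemma left_ideal_nonzero: "left_ideal I \<Longrightarrow> I \<noteq> {0} \<Longrightarrow> \<exists>a\<in>I. a \<noteq> 0"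
  using left_idealD(1) by blast

lemma left_ideal_left_annihilator: "left_ideal (left_annihilator T)"
  by (auto simp: left_ideal_def left_annihilator_def distrib_right mult.assoc)

lemma left_ideal_Int: "left_ideal I \<Longrightarrow> left_ideal J \<Longrightarrow> left_ideal (I \<inter> J)"
  by (auto simp: left_ideal_def)

lemma left_ideal_principal: "left_ideal (range (\<lambda>r. r * (a::'a::ring_1)))"
  unfolding left_ideal_def
proof (intro conjI ballI allI)
  show "0 \<in> range (\<lambda>r. r * a)" using rangeI[of "\<lambda>r. r * a" 0] by simp
  fix x assume "x \<in> range (\<lambda>r. r * a)"
  then obtain p where p: "x = p * a" by blast
  show "- x \<in> range (\<lambda>r. r * a)" using rangeI[of "\<lambda>r. r * a" "- p"] p by simp
  show "r * x \<in> range (\<lambda>r. r * a)" for r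
    using rangeI[of "\<lambda>r. r * a" "r * p"] p by (simp add: mult.assoc)
  fix y assume "y \<in> range (\<lambda>r. r * a)"
  then obtain q where "y = q * a" by blast
  then show "x + y \<in> range (\<lambda>r. r * a)"
    using rangeI[of "\<lambda>r. r * a" "p + q"] p by (simp add: distrib_right)
qed

text \<open>With \<open>T = {t. b R t = 0}\<close>, the element \<open>b\<close> lies in the ideal \<open>T \<inter> left_annihilator T\<close>,
  whose square is zero.\<close>

lemma semiprime_square_zero:
  fixes b :: "'a::ring_1"
  assumes sp: "semiprime_ring TYPE('a)" and b: "\<And>r. b * r * b = 0"
  shows "b = 0"
proof -
  define T where "T = {t. \<forall>r. b * r * t = 0}"
  define I where "I = T \<inter> left_annihilator T"
  have T1: "r * t \<in> T" if "t \<in> T" for r t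
  proof -
    have "b * (q * r) * t = 0" for q using that by (simp add: T_def)
    then show ?thesis by (simp add: T_def mult.assoc)
  qed
  have T2: "t * r \<in> T" if "t \<in> T" for r t
    using that unfolding T_def by (simp add: mult.assoc[symmetric])
  have lT: "left_ideal T"
    using T1 by (auto simp: left_ideal_def T_def distrib_left)
  have "a * r \<in> I" if "a \<in> I" for a r
    using that T1 T2 by (auto simp: I_def left_annihilator_def mult.assoc)
  then have "two_sided_ideal I"
    using left_ideal_Int[OF lT left_ideal_left_annihilator[of T]] by (auto simp: two_sided_ideal_def I_def)
  moreover have "nilpotent_ideal I"
    unfolding nilpotent_ideal_def
  proof (intro exI[of _ 2] conjI allI impI)
    fix xs :: "'a list" assume xs: "length xs = 2 \<and> set xs \<subseteq> I"
    then obtain x y where "xs = [x, y]"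
      by (auto simp: numeral_2_eq_2 length_Suc_conv)
    with xs show "prod_list xs = 0" by (auto simp: I_def left_annihilator_def)
  qed simp
  ultimately have "I = {0}" using sp by (auto simp: semiprime_ring_def)
  \<comment> \<open>The hypothesis puts \<open>b\<close> in \<open>T\<close>, and the case
    \<open>r = 1\<close> of the definition of \<open>T\<close> shows that \<open>b\<close>
    annihilates \<open>T\<close> from the left.\<close>
  moreover have "b \<in> I"
    using b by (auto simp: I_def T_def left_annihilator_def) (metis mult.right_neutral)
  ultimately show ?thesis by simp
qed

text \<open>If \<open>t\<close> kills \<open>I\<close> on one side, each product on the other side,
  say \<open>p = i * t\<close>, satisfies \<open>p * r * p = 0\<close>: the middle of this product
  contains \<open>t * (r * i)\<close>, and \<open>r * i\<close> is again in \<open>I\<close>. So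
  \<open>p\<close> vanishes by \<open>semiprime_square_zero\<close>.\<close>

lemma semiprime_annihilators_eq:
  fixes t :: "'a::ring_1"
  assumes sp: "semiprime_ring TYPE('a)" and I: "two_sided_ideal I"
  shows "(\<forall>i\<in>I. t * i = 0) \<longleftrightarrow> (\<forall>i\<in>I. i * t = 0)"
proof (intro iffI ballI)
  fix i assume t: "\<forall>i\<in>I. t * i = 0" and i: "i \<in> I"
  have "(i * t) * r * (i * t) = 0" for r
  proof -
    have "t * (r * i) = 0" using t i I by (auto simp: two_sided_ideal_def left_ideal_def)
    moreover have "(i * t) * r * (i * t) = i * (t * (r * i)) * t" by (simp add: mult.assoc)
    ultimately show ?thesis by simp
  qed
  then show "i * t = 0" by (rule semiprime_square_zero[OF sp])
next
  fix i assume t: "\<forall>i\<in>I. i * t = 0" and i: "i \<in> I"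
  have "(t * i) * r * (t * i) = 0" for r
  proof -
    have "i * r * t = 0" using t i I by (auto simp: two_sided_ideal_def)
    moreover have "(t * i) * r * (t * i) = t * (i * r * t) * i" by (simp add: mult.assoc)
    ultimately show ?thesis by simp
  qed
  then show "t * i = 0" by (rule semiprime_square_zero[OF sp])
qed

section \<open>Elements obtained from the chain condition on left annihilators\<close>

lemma acc_left_annihilators_maximal:
  fixes C :: "'a::ring_1 set set"
  assumes acc: "acc_left_annihilators TYPE('a)" and ne: "C \<noteq> {}"
    and C: "\<And>A. A \<in> C \<Longrightarrow> \<exists>T. A = left_annihilator T"
  shows "\<exists>M\<in>C. \<forall>A\<in>C. M \<subseteq> A \<longrightarrow> A = M"
proof (rule ccontr)
  assume "\<not> ?thesis"
  then have step: "\<exists>B. B \<in> C \<and> A \<subset> B" if "A \<in> C" for A using that by blast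
  have "\<exists>f. \<forall>n. f n \<in> C \<and> f n \<subset> f (Suc n)"
    by (rule dependent_nat_choice) (use ne step in auto)
  then obtain f where "\<And>n. f n \<in> C" "\<And>n. f n \<subset> f (Suc n)" by blast
  then show False using acc C unfolding acc_left_annihilators_def by blast
qed

text \<open>If every element of \<open>I\<close> were nilpotent, so would be every
  \<open>a * s\<close> with \<open>a\<close> in \<open>I\<close>. A nonzero \<open>b = a * s\<close>
  with maximal left annihilator then satisfies \<open>b * r * b = 0\<close> for all
  \<open>r\<close>, against semiprimeness.\<close>

lemma exists_nonnilpotent:
  fixes I :: "'a::ring_1 set"
  assumes sp: "semiprime_ring TYPE('a)" and acc: "acc_left_annihilators TYPE('a)"
    and I: "left_ideal I" "I \<noteq> {0}"
  shows "\<exists>a\<in>I. \<forall>n. a ^ n \<noteq> 0"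
proof (rule ccontr)
  assume "\<not> ?thesis"
  then have nil: "\<exists>n. a ^ n = 0" if "a \<in> I" for a using that by blast
  obtain a where a: "a \<in> I" "a \<noteq> 0" using left_ideal_nonzero[OF I] by blast
  \<comment> \<open>Nilpotency is known for \<open>s * a\<close>, which lies in \<open>I\<close>;
    this identity carries it over to \<open>a * s\<close>, which need not.\<close>
  have shift: "(a * s) ^ n * a = a * (s * a) ^ n" for s n
    by (induction n) (simp_all add: mult.assoc)
  have nilR: "\<exists>n. (a * s) ^ n = 0" for s
  proof -
    obtain n where "(s * a) ^ n = 0" using nil[of "s * a"] a I left_idealD(4) by blast
    then have "(a * s) ^ Suc n = 0"
      by (subst power_Suc2) (simp add: mult.assoc[symmetric] shift)
    then show ?thesis by blast
  qed
  define C where "C = {left_annihilator {a * s} | s. a * s \<noteq> 0}"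
  have "left_annihilator {a * 1} \<in> C" using a unfolding C_def by (intro CollectI exI[of _ 1]) simp
  then have "\<exists>M\<in>C. \<forall>A\<in>C. M \<subseteq> A \<longrightarrow> A = M"
    by (intro acc_left_annihilators_maximal[OF acc]) (auto simp: C_def)
  then obtain M where M: "M \<in> C" "\<And>A. A \<in> C \<Longrightarrow> M \<subseteq> A \<Longrightarrow> A = M" by blast
  then obtain s where s: "a * s \<noteq> 0" and Ms: "M = left_annihilator {a * s}"
    unfolding C_def by blast
  have max: "\<And>u. a * u \<noteq> 0 \<Longrightarrow> left_annihilator {a * s} \<subseteq> left_annihilator {a * u} \<Longrightarrow>
       left_annihilator {a * u} = left_annihilator {a * s}"
    unfolding Ms[symmetric] by (rule M(2)) (auto simp: C_def)
  define b where "b = a * s"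
  have "b * r * b = 0" for r
  proof (cases "b * r = 0")
    case False
    define y where "y = b * r"
    have "\<exists>k. y ^ k = 0" using nilR[of "s * r"] by (simp add: y_def b_def mult.assoc)
    then have k: "y ^ (LEAST k. y ^ k = 0) = 0" by (rule LeastI_ex)
    have k0: "(LEAST k. y ^ k = 0) \<noteq> 0" using k by (metis power_0 zero_neq_one)
    have "(LEAST k. y ^ k = 0) \<noteq> 1" using k False by (metis power_one_right y_def)
    with k0 obtain j where j: "(LEAST k. y ^ k = 0) = Suc (Suc j)"
      by (metis One_nat_def not0_implies_Suc)
    \<comment> \<open>The last nonzero power of \<open>y\<close> is a right multiple of
      \<open>b\<close>, so by maximality it has the same left annihilator as \<open>b\<close>. Since
      \<open>y\<close> annihilates that power, \<open>y * b = 0\<close>.\<close>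
    have nz: "y ^ Suc j \<noteq> 0" using not_less_Least[of "Suc j" "\<lambda>k. y ^ k = 0"] j by auto
    have e: "y ^ Suc j = a * (s * r * y ^ j)" by (simp add: y_def b_def mult.assoc)
    have "left_annihilator {a * s} \<subseteq> left_annihilator {a * (s * r * y ^ j)}"
      by (auto simp: left_annihilator_def mult.assoc[symmetric])
    then have "left_annihilator {y ^ Suc j} = left_annihilator {b}"
      using max[of "s * r * y ^ j"] nz e b_def by simp
    moreover have "y \<in> left_annihilator {y ^ Suc j}"
      using k j by (simp add: left_annihilator_def)
    ultimately show ?thesis by (simp add: y_def left_annihilator_def)
  qed simp
  then have "b = 0" by (rule semiprime_square_zero[OF sp])
  then show False using s b_def by simp
qed

text \<open>Equivalently, the left ideal generated by \<open>c\<close> meets the left annihilator of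
  \<open>c\<close> only in 0. In particular 0 is square regular.\<close>

definition square_regular :: "'a::ring_1 \<Rightarrow> bool" where
  "square_regular c \<longleftrightarrow> (\<forall>r. r * c * c = 0 \<longrightarrow> r * c = 0)"

text \<open>The left annihilators of the powers of a nonnilpotent element ascend. A power
  \<open>p\<close> whose annihilator is maximal has the same left annihilator as
  \<open>p * p\<close>.\<close>

lemma exists_square_regular:
  fixes I :: "'a::ring_1 set"
  assumes sp: "semiprime_ring TYPE('a)" and acc: "acc_left_annihilators TYPE('a)"
    and I: "left_ideal I" "I \<noteq> {0}"
  shows "\<exists>a\<in>I. a \<noteq> 0 \<and> square_regular a"
proof -
  obtain a where a: "a \<in> I" "\<And>n. a ^ n \<noteq> 0" using exists_nonnilpotent[OF assms] by blast
  \<comment> \<open>Exponents start at 1, since \<open>a ^ 0 = 1\<close> need not lie in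
    \<open>I\<close>.\<close>
  define C where "C = range (\<lambda>n. left_annihilator {a ^ Suc n})"
  have "\<exists>M\<in>C. \<forall>A\<in>C. M \<subseteq> A \<longrightarrow> A = M"
    by (rule acc_left_annihilators_maximal[OF acc]) (auto simp: C_def)
  then obtain M where M: "M \<in> C" "\<And>A. A \<in> C \<Longrightarrow> M \<subseteq> A \<Longrightarrow> A = M" by blast
  then obtain n where "M = left_annihilator {a ^ Suc n}" by (auto simp: C_def)
  then have n: "\<And>m. left_annihilator {a ^ Suc n} \<subseteq> left_annihilator {a ^ Suc m} \<Longrightarrow>
       left_annihilator {a ^ Suc m} = left_annihilator {a ^ Suc n}"
    using M(2) by (simp add: C_def)
  define p where "p = a ^ Suc n"
  have sq: "a ^ Suc (Suc (n + n)) = p * p"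
    unfolding p_def by (metis add_Suc add_Suc_right power_add)
  have "left_annihilator {p} \<subseteq> left_annihilator {p * p}"
    by (simp add: left_annihilator_def mult.assoc[symmetric] Collect_mono)
  then have eq: "left_annihilator {p * p} = left_annihilator {p}"
    using n[of "Suc (n + n)"] sq by (simp only: p_def)
  have "square_regular p"
    unfolding square_regular_def
  proof (intro allI impI)
    fix r assume "r * p * p = 0"
    then have "r \<in> left_annihilator {p * p}" by (simp add: left_annihilator_def mult.assoc)
    then show "r * p = 0" unfolding eq by (simp add: left_annihilator_def)
  qed
  moreover have "p \<in> I"
    unfolding p_def power_Suc2 by (rule left_idealD(4)[OF I(1) a(1)])
  moreover have "p \<noteq> 0" unfolding p_def by (rule a(2))
  ultimately show ?thesis by blast
qed

text \<open>As \<open>a * c = 0\<close>, multiplying on the right by \<open>c\<close> removes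
  \<open>a\<close>: \<open>r * (c + a) * c = r * c * c\<close>. Regularity of \<open>c\<close> thus
  separates the two summands.\<close>

lemma square_regular_add:
  fixes a c :: "'a::ring_1"
  assumes c: "square_regular c" and a: "square_regular a" and ac: "a * c = 0"
  shows "r * (c + a) = 0 \<longleftrightarrow> r * c = 0 \<and> r * a = 0" "square_regular (c + a)"
proof -
  have ann: "r * c = 0 \<and> r * a = 0" if "r * (c + a) = 0" for r
  proof -
    have "r * c * c = r * (c + a) * c"
      by (simp add: distrib_left distrib_right mult.assoc ac)
    then have "r * c = 0" using c that by (simp add: square_regular_def)
    then show ?thesis using that by (simp add: distrib_left)
  qed
  then show "r * (c + a) = 0 \<longleftrightarrow> r * c = 0 \<and> r * a = 0" by (auto simp: distrib_left)
  show "square_regular (c + a)"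
    unfolding square_regular_def
  proof (intro allI impI)
    fix r assume "r * (c + a) * (c + a) = 0"
    from ann[OF this] have 1: "r * (c + a) * c = 0" and 2: "r * (c + a) * a = 0" by auto
    have "r * c * c = 0" using 1 by (simp add: distrib_left distrib_right mult.assoc ac)
    then have rc: "r * c = 0" using c by (simp add: square_regular_def)
    then have "r * a * a = 0" using 2 by (simp add: distrib_left distrib_right)
    then have "r * a = 0" using a by (simp add: square_regular_def)
    with rc show "r * (c + a) = 0" by (simp add: distrib_left)
  qed
qed

text \<open>If no such \<open>c\<close> existed, one could keep adding to a square regular \<open>c\<close> a nonzero square
  regular element of \<open>I\<close> annihilating \<open>c\<close> from the left; the left ideals generated by the added
  elements are independent.\<close>

lemma goldie_exists_left_regular:
  fixes I :: "'a::ring_1 set"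
  assumes sp: "semiprime_ring TYPE('a)" and goldie: "left_goldie TYPE('a)" and I: "left_ideal I"
  shows "\<exists>c\<in>I. \<forall>r\<in>I. r * c = 0 \<longrightarrow> r = 0"
proof (rule ccontr)
  assume neg: "\<not> ?thesis"
  have acc: "acc_left_annihilators TYPE('a)" using goldie by (simp add: left_goldie_def)
  have step: "\<exists>a. a \<in> I \<and> a \<noteq> 0 \<and> square_regular a \<and> a * c = 0" if "c \<in> I" for c
  proof -
    have L: "left_ideal (I \<inter> left_annihilator {c})"
      by (rule left_ideal_Int[OF I left_ideal_left_annihilator])
    moreover have "I \<inter> left_annihilator {c} \<noteq> {0}"
      using neg that by (auto simp: left_annihilator_def set_eq_iff)
    ultimately show ?thesis
      using exists_square_regular[OF sp acc] by (fastforce simp: left_annihilator_def)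
  qed
  \<comment> \<open>Here \<open>f n\<close> is the accumulated element and
    \<open>f (Suc n) - f n\<close> the one added to it; the recursion can start because 0 is square
    regular.\<close>
  have "\<exists>f. \<forall>n. (f n \<in> I \<and> square_regular (f n)) \<and>
     (f (Suc n) - f n \<noteq> 0 \<and> square_regular (f (Suc n) - f n) \<and> (f (Suc n) - f n) * f n = 0)"
  proof (rule dependent_nat_choice)
    show "\<exists>x. x \<in> I \<and> square_regular x"
      using left_idealD(1)[OF I] by (auto simp: square_regular_def)
  next
    fix x and n :: nat
    assume x: "x \<in> I \<and> square_regular x"
    then obtain a where a: "a \<in> I" "a \<noteq> 0" "square_regular a" "a * x = 0" using step by blast
    show "\<exists>y. (y \<in> I \<and> square_regular y) \<and> y - x \<noteq> 0 \<and> square_regular (y - x) \<and> (y - x) * x = 0"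
      using a x left_idealD(2)[OF I] square_regular_add(2)[of x a] by (intro exI[of _ "x + a"]) auto
  qed
  then obtain f where "\<forall>n. (f n \<in> I \<and> square_regular (f n)) \<and>
     (f (Suc n) - f n \<noteq> 0 \<and> square_regular (f (Suc n) - f n) \<and> (f (Suc n) - f n) * f n = 0)"
    by (rule exE)
  then have f: "\<And>n. square_regular (f n)"
    "\<And>n. f (Suc n) - f n \<noteq> 0" "\<And>n. square_regular (f (Suc n) - f n)"
    "\<And>n. (f (Suc n) - f n) * f n = 0" by simp_all
  define a where "a n = f (Suc n) - f n" for n
  have ann: "r * f (Suc n) = 0 \<longleftrightarrow> r * f n = 0 \<and> r * a n = 0" for r n
    using square_regular_add(1)[OF f(1)[of n] f(3)[of n] f(4)[of n], of r] by (simp add: a_def)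
  \<comment> \<open>By \<open>ann\<close>, whatever annihilates \<open>f n\<close> from the left
    annihilates all summands added before. Since \<open>a i\<close> annihilates \<open>f i\<close>,
    it follows that \<open>a i * a j = 0\<close> for \<open>j < i\<close>.\<close>
  have ann_mono: "r * f n = 0 \<Longrightarrow> j < n \<Longrightarrow> r * a j = 0" for r n j
    by (induction n) (auto simp: ann less_Suc_eq)
  have aa: "a i * a j = 0" if "j < i" for i j
    using ann_mono[of "a i" i j] f(4)[of i] that by (simp add: a_def)
  define L where "L n = range (\<lambda>r. r * a n)" for n
  have "has_infinite_direct_sum_left_ideals TYPE('a)"
    unfolding has_infinite_direct_sum_left_ideals_def
  proof (intro exI[of _ L] conjI allI impI)
    fix i
    show "left_ideal (L i)" unfolding L_def by (rule left_ideal_principal)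
    have "1 * a i \<in> L i" unfolding L_def by blast
    then show "L i \<noteq> {0}" using f(2)[of i] by (auto simp: a_def)
  next
    fix n i and b :: "nat \<Rightarrow> 'a"
    assume b: "(\<forall>i<n. b i \<in> L i) \<and> (\<Sum>i<n. b i) = 0"
    have "i < n \<longrightarrow> b i = 0"
    proof (induction i rule: less_induct)
      case (less i)
      show ?case
      proof
        assume i: "i < n"
        \<comment> \<open>Multiply the relation on the right by \<open>a i\<close>: terms with
          \<open>j > i\<close> vanish because \<open>a j * a i = 0\<close>, those with
          \<open>j < i\<close> by induction. Only \<open>b i * a i = 0\<close> remains, and square
          regularity of \<open>a i\<close> gives \<open>b i = 0\<close>.\<close>
        have z: "b j * a i = 0" if "j < n" "j \<noteq> i" for j
        proof (cases "j < i")
          case False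
          then have "a j * a i = 0" using that aa by simp
          moreover have "b j \<in> L j" using b that by blast
          ultimately show ?thesis by (auto simp: L_def mult.assoc)
        qed (use less that in auto)
        have "0 = (\<Sum>j<n. b j) * a i" using b by simp
        also have "\<dots> = (\<Sum>j<n. b j * a i)" by (rule sum_distrib_right)
        also have "\<dots> = (\<Sum>j\<in>{i}. b j * a i)"
          by (rule sum.mono_neutral_right) (use i z in auto)
        finally have "b i * a i = 0" by simp
        moreover obtain r where "b i = r * a i" using b i by (auto simp: L_def)
        ultimately show "b i = 0" using f(3)[of i] by (simp add: square_regular_def a_def)
      qed
    qed
    then show "i < n \<Longrightarrow> b i = 0" by simp
  qed
  then show False using goldie by (simp add: left_goldie_def)
qed

section \<open>The Jacobson radical\<close>

text \<open>A left ideal is proper exactly when it omits 1, a condition that passes to unions of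
  chains, so Zorn's lemma applies.\<close>

lemma exists_maximal_left_ideal:
  fixes I :: "'a::ring_1 set"
  assumes I: "left_ideal I" "1 \<notin> I"
  shows "\<exists>M. maximal_left_ideal M \<and> I \<subseteq> M"
proof -
  define A where "A = {K. left_ideal K \<and> I \<subseteq> K \<and> (1::'a) \<notin> K}"
  have "\<exists>M\<in>A. \<forall>K\<in>A. M \<subseteq> K \<longrightarrow> K = M"
  proof (rule subset_Zorn_nonempty)
    show "A \<noteq> {}" using I by (auto simp: A_def)
    fix C assume C: "C \<noteq> {}" "subset.chain A C"
    then have ch: "K \<subseteq> K' \<or> K' \<subseteq> K" if "K \<in> C" "K' \<in> C" for K K'
      using that by (auto simp: subset.chain_def)
    have CA: "C \<subseteq> A" using C by (auto simp: subset.chain_def)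
    then have CL: "left_ideal K" if "K \<in> C" for K using that by (auto simp: A_def)
    have "left_ideal (\<Union> C)"
      unfolding left_ideal_def
    proof (intro conjI ballI allI)
      show "0 \<in> \<Union> C" using C(1) CL left_idealD(1) by blast
      show "a + b \<in> \<Union> C" if ab: "a \<in> \<Union> C" "b \<in> \<Union> C" for a b
      proof -
        obtain K K' where K: "K \<in> C" "a \<in> K" "K' \<in> C" "b \<in> K'" using ab by blast
        then show ?thesis using ch[OF K(1,3)] left_idealD(2)[OF CL] by blast
      qed
      show "- a \<in> \<Union> C" if "a \<in> \<Union> C" for a using that CL left_idealD(3) by blast
      show "r * a \<in> \<Union> C" if "a \<in> \<Union> C" for a r using that CL left_idealD(4) by blast
    qed
    then show "\<Union> C \<in> A" using C(1) CA by (auto simp: A_def)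
  qed
  then obtain M where M: "M \<in> A" "\<And>K. K \<in> A \<Longrightarrow> M \<subseteq> K \<Longrightarrow> K = M" by blast
  have "maximal_left_ideal M"
    unfolding maximal_left_ideal_def
  proof (intro conjI allI impI)
    show "left_ideal M" "M \<noteq> UNIV" using M(1) by (auto simp: A_def)
    fix K assume K: "left_ideal K \<and> M \<subseteq> K \<and> K \<noteq> UNIV"
    then have "K \<in> A" using M(1) left_ideal_one[of K] by (auto simp: A_def)
    then show "K = M" using M(2) K by blast
  qed
  then show ?thesis using M(1) by (auto simp: A_def)
qed

lemma left_ideal_jacobson_radical: "left_ideal (jacobson_radical TYPE('a::ring_1))"
proof -
  have "left_ideal M" if "maximal_left_ideal M" for M :: "'a set"
    using that by (simp add: maximal_left_ideal_def)
  then show ?thesis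
    unfolding jacobson_radical_def by (subst left_ideal_def) (simp add: left_idealD)
qed

text \<open>No maximal left ideal contains \<open>1 + g\<close>, because it would contain
  \<open>g\<close> and hence 1. So the left ideal generated by \<open>1 + g\<close> is not
  proper.\<close>

lemma jacobson_radical_left_inverse:
  fixes g :: "'a::ring_1"
  assumes g: "g \<in> jacobson_radical TYPE('a)"
  shows "\<exists>h. h * (1 + g) = 1"
proof (rule ccontr)
  assume "\<not> ?thesis"
  then have "1 \<notin> range (\<lambda>r. r * (1 + g))" by (metis imageE)
  then obtain M where M: "maximal_left_ideal M" "range (\<lambda>r. r * (1 + g)) \<subseteq> M"
    using exists_maximal_left_ideal[OF left_ideal_principal] by blast
  have L: "left_ideal M" using M(1) by (simp add: maximal_left_ideal_def)
  have "1 * (1 + g) \<in> M" using M(2) by blast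
  moreover have "g \<in> M" using g M(1) by (auto simp: jacobson_radical_def)
  ultimately have "(1 + g) - g \<in> M" using left_ideal_diff[OF L, of "1 + g" g] by simp
  then have "M = UNIV" using left_ideal_one[OF L] by simp
  then show False using M(1) by (simp add: maximal_left_ideal_def)
qed

text \<open>This is the annihilator of the class of \<open>r\<close> in the simple left module of
  cosets of \<open>M\<close>. It serves to show that the radical is closed under right
  multiplication.\<close>

lemma maximal_left_ideal_colon:
  fixes M :: "'a::ring_1 set"
  assumes M: "maximal_left_ideal M" and r: "r \<notin> M"
  shows "maximal_left_ideal {s. s * r \<in> M}"
proof -
  have L: "left_ideal M" using M by (simp add: maximal_left_ideal_def)
  have L': "left_ideal {s. s * r \<in> M}"
    using L by (auto simp: left_ideal_def distrib_right mult.assoc)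
  show ?thesis
    unfolding maximal_left_ideal_def
  proof (intro conjI allI impI)
    show "left_ideal {s. s * r \<in> M}" by (rule L')
    have "1 \<notin> {s. s * r \<in> M}" using r by simp
    then show "{s. s * r \<in> M} \<noteq> UNIV" by blast
    fix K assume K: "left_ideal K \<and> {s. s * r \<in> M} \<subseteq> K \<and> K \<noteq> UNIV"
    show "K = {s. s * r \<in> M}"
    proof (rule ccontr)
      assume "K \<noteq> {s. s * r \<in> M}"
      then obtain s where s: "s \<in> K" "s * r \<notin> M" using K by blast
      \<comment> \<open>The left ideal generated by \<open>M\<close> and \<open>s * r\<close> is
        strictly larger than \<open>M\<close>, hence contains \<open>r\<close>. Writing
        \<open>r\<close> accordingly puts \<open>1 - t * s\<close> in the colon ideal, so 1 lies in
        \<open>K\<close>.\<close>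
      define N where "N = {m + t * (s * r) | m t. m \<in> M}"
      have "left_ideal N"
        unfolding left_ideal_def
      proof (intro conjI ballI allI)
        have "0 + 0 * (s * r) \<in> N" using left_idealD(1)[OF L] unfolding N_def by blast
        then show "0 \<in> N" by simp
        fix x assume "x \<in> N"
        then obtain m t where x: "x = m + t * (s * r)" "m \<in> M" by (auto simp: N_def)
        have "- m + (- t) * (s * r) \<in> N" using x left_idealD(3)[OF L] unfolding N_def by blast
        then show "- x \<in> N" using x by simp
        have "q * m + (q * t) * (s * r) \<in> N" for q
          using x left_idealD(4)[OF L] unfolding N_def by blast
        then show "q * x \<in> N" for q using x by (simp add: distrib_left mult.assoc)
        fix y assume "y \<in> N"
        then obtain m' t' where y: "y = m' + t' * (s * r)" "m' \<in> M" by (auto simp: N_def)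
        have "(m + m') + (t + t') * (s * r) \<in> N" using x y left_idealD(2)[OF L] unfolding N_def by blast
        then show "x + y \<in> N" using x y by (simp add: algebra_simps)
      qed
      moreover have "M \<subseteq> N"
      proof
        fix m assume "m \<in> M"
        then have "m + 0 * (s * r) \<in> N" unfolding N_def by blast
        then show "m \<in> N" by simp
      qed
      moreover have "N \<noteq> M"
      proof -
        have "0 + 1 * (s * r) \<in> N" using left_idealD(1)[OF L] unfolding N_def by blast
        then show ?thesis using s by auto
      qed
      ultimately have "N = UNIV" using M by (auto simp: maximal_left_ideal_def)
      then have "r \<in> N" by simp
      then obtain m t where mt: "r = m + t * (s * r)" "m \<in> M" by (auto simp: N_def)
      then have "(1 - t * s) * r \<in> M" by (metis add_diff_cancel_right' left_diff_distrib mult.assoc mult.left_neutral)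
      then have "1 - t * s \<in> K" using K by blast
      then have "(1 - t * s) + t * s \<in> K" using K s left_idealD(2,4) by blast
      then show False using K left_ideal_one[of K] by simp
    qed
  qed
qed

lemma jacobson_radical_mult_right:
  fixes g :: "'a::ring_1"
  assumes g: "g \<in> jacobson_radical TYPE('a)"
  shows "g * r \<in> jacobson_radical TYPE('a)"
proof -
  have "g * r \<in> M" if M: "maximal_left_ideal M" for M
  proof (cases "r \<in> M")
    case True
    then show ?thesis using M left_idealD(4) by (auto simp: maximal_left_ideal_def)
  next
    case False
    then show ?thesis using g maximal_left_ideal_colon[OF M] by (auto simp: jacobson_radical_def)
  qed
  then show ?thesis by (simp add: jacobson_radical_def)
qed

section \<open>Ideals and ring automorphisms\<close>

lemma ring_automorphismD:
  assumes "ring_automorphism f"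
  shows "f (a + b) = f a + f b" "f (a * b) = f a * f b" "f 1 = 1" "f 0 = 0" "f (- a) = - f a"
    "f a = 0 \<longleftrightarrow> a = 0" "bij f"
proof -
  show add: "f (a + b) = f a + f b" and "f (a * b) = f a * f b" "f 1 = 1" "bij f" for a b
    using assms by (auto simp: ring_automorphism_def ring_hom_1_def)
  show z: "f 0 = 0" using add[of 0 0] by simp
  show "f (- a) = - f a" using add[of "- a" a] z by (simp add: eq_neg_iff_add_eq_0)
  show "f a = 0 \<longleftrightarrow> a = 0" using z \<open>bij f\<close> by (metis bij_pointE)
qed

lemma ring_automorphism_id: "ring_automorphism (\<lambda>x. x)"
  using bij_id by (simp add: ring_automorphism_def ring_hom_1_def id_def)

lemma ring_automorphism_comp:
  "ring_automorphism f \<Longrightarrow> ring_automorphism g \<Longrightarrow> ring_automorphism (f \<circ> g)"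
  by (auto simp: ring_automorphism_def ring_hom_1_def bij_comp)

lemma ring_automorphism_inv:
  assumes f: "ring_automorphism f"
  shows "ring_automorphism (inv f)"
proof -
  have b: "bij f" by (rule ring_automorphismD(7)[OF f])
  then have fi: "f (inv f x) = x" for x by (simp add: bij_is_surj surj_f_inv_f)
  have i: "inv f x = y" if "x = f y" for x y using that b by (simp add: bij_is_inj)
  show ?thesis
    unfolding ring_automorphism_def ring_hom_1_def
    using b by (auto intro!: i bij_imp_bij_inv simp: ring_automorphismD(1-3)[OF f] fi)
qed

lemma two_sided_idealD:
  assumes "two_sided_ideal I"
  shows "left_ideal I" "a \<in> I \<Longrightarrow> a * r \<in> I" "a \<in> I \<Longrightarrow> r * a \<in> I"
  using assms by (auto simp: two_sided_ideal_def left_ideal_def)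

lemma two_sided_ideal_image:
  assumes f: "ring_automorphism f" and I: "two_sided_ideal I"
  shows "two_sided_ideal (f ` I)"
proof -
  note fD = ring_automorphismD[OF f] and L = left_idealD[OF two_sided_idealD(1)[OF I]]
  have surj: "\<exists>s. r = f s" for r using fD(7) by (metis bij_pointE)
  show ?thesis
    unfolding two_sided_ideal_def left_ideal_def
  proof (intro conjI ballI allI)
    show "0 \<in> f ` I" using L(1) fD(4) by force
    fix a assume "a \<in> f ` I"
    then obtain a' where a: "a = f a'" "a' \<in> I" by blast
    show "- a \<in> f ` I" using a L(3) fD(5) by (metis imageI)
    show "r * a \<in> f ` I" for r using surj[of r] a L(4) fD(2) by (metis imageI)
    show "a * r \<in> f ` I" for r using surj[of r] a two_sided_idealD(2)[OF I] fD(2) by (metis imageI)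
    fix b assume "b \<in> f ` I"
    then show "a + b \<in> f ` I" using a L(2) fD(1) by (metis (no_types, lifting) imageE imageI)
  qed
qed

section \<open>Coefficients in a free skew extension\<close>

locale skew_extension =
  fixes \<iota> :: "'r::ring_1 \<Rightarrow> 's::ring_1"
    and var :: "'x \<Rightarrow> 's"
    and \<sigma> \<delta> :: "'x \<Rightarrow> 'r \<Rightarrow> 'r"
  assumes automorphism: "\<And>x. ring_automorphism (\<sigma> x)"
    and derivation: "\<And>x. sigma_derivation (\<sigma> x) (\<delta> x)"
    and extension: "free_skew_extension \<iota> var \<sigma> \<delta>"
begin

abbreviation word :: "'x list \<Rightarrow> 's" where "word \<equiv> word_elem var"

definition coeff :: "'s \<Rightarrow> 'x list \<Rightarrow> 'r" where
  "coeff s = (THE c. finite {w. c w \<noteq> 0} \<and> s = (\<Sum>w\<in>{w. c w \<noteq> 0}. \<iota> (c w) * word w))"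

lemma coeff_ex1: "\<exists>!c. finite {w. c w \<noteq> 0} \<and> s = (\<Sum>w\<in>{w. c w \<noteq> 0}. \<iota> (c w) * word w)"
  using extension by (simp add: free_skew_extension_def)

lemma finite_coeff: "finite {w. coeff s w \<noteq> 0}"
  and sum_coeff: "s = (\<Sum>w\<in>{w. coeff s w \<noteq> 0}. \<iota> (coeff s w) * word w)"
  using theI'[OF coeff_ex1[of s]] unfolding coeff_def by auto

lemma hom_add: "\<iota> (a + b) = \<iota> a + \<iota> b" and hom_mult: "\<iota> (a * b) = \<iota> a * \<iota> b" and hom_1: "\<iota> 1 = 1"
  using extension by (auto simp: free_skew_extension_def ring_hom_1_def)

lemma hom_0: "\<iota> 0 = 0" using hom_add[of 0 0] by simp

lemma hom_eq_0: "\<iota> a = 0 \<Longrightarrow> a = 0"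
  using extension hom_0 by (auto simp: free_skew_extension_def inj_def)

lemma var_hom: "var x * \<iota> r = \<iota> (\<sigma> x r) * var x + \<iota> (\<delta> x r)"
  using extension by (auto simp: free_skew_extension_def)

lemma word_Nil: "word [] = 1" and word_Cons: "word (x # w) = var x * word w"
  by (simp_all add: word_elem_def)

lemma der_0: "\<delta> x 0 = 0" and der_add: "\<delta> x (a + b) = \<delta> x a + \<delta> x b"
proof -
  show "\<delta> x (a + b) = \<delta> x a + \<delta> x b" for a b using derivation by (auto simp: sigma_derivation_def)
  from this[of 0 0] show "\<delta> x 0 = 0" by simp
qed

text \<open>Uniqueness of the expansion, relaxed to any finite index set containing the support, so
  that exact supports of sums and multiples never have to be computed.\<close>

lemma coeff_eqI:
  assumes "finite A" "s = (\<Sum>w\<in>A. \<iota> (c w) * word w)" "\<And>w. w \<notin> A \<Longrightarrow> c w = 0"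
  shows "coeff s = c"
proof -
  have sub: "{w. c w \<noteq> 0} \<subseteq> A" using assms(3) by blast
  have "s = (\<Sum>w\<in>{w. c w \<noteq> 0}. \<iota> (c w) * word w)"
    unfolding assms(2) by (rule sum.mono_neutral_right) (use assms(1) sub in \<open>auto simp: hom_0\<close>)
  then show ?thesis
    unfolding coeff_def
    using finite_subset[OF sub assms(1)] by (intro the1_equality[OF coeff_ex1]) auto
qed

lemma sum_coeff_superset:
  assumes "finite A" "{w. coeff s w \<noteq> 0} \<subseteq> A"
  shows "(\<Sum>w\<in>A. \<iota> (coeff s w) * word w) = s"
proof -
  have "(\<Sum>w\<in>A. \<iota> (coeff s w) * word w) = (\<Sum>w\<in>{w. coeff s w \<noteq> 0}. \<iota> (coeff s w) * word w)"
    by (rule sum.mono_neutral_right) (use assms in \<open>auto simp: hom_0\<close>)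
  also have "\<dots> = s" by (rule sum_coeff[symmetric])
  finally show ?thesis .
qed

lemma coeff_add: "coeff (s + t) w = coeff s w + coeff t w"
proof -
  let ?A = "{w. coeff s w \<noteq> 0} \<union> {w. coeff t w \<noteq> 0}"
  have A: "finite ?A" using finite_coeff by blast
  have "coeff (s + t) = (\<lambda>w. coeff s w + coeff t w)"
    by (rule coeff_eqI[OF A])
      (auto simp: hom_add distrib_right sum.distrib sum_coeff_superset[OF A])
  then show ?thesis by simp
qed

lemma coeff_monomial: "coeff (\<iota> r * word w) u = (if u = w then r else 0)"
proof -
  have "coeff (\<iota> r * word w) = (\<lambda>u. if u = w then r else 0)"
    by (rule coeff_eqI[of "{w}"]) auto
  then show ?thesis by simp
qed

lemma coeff_hom: "coeff (\<iota> r) u = (if u = [] then r else 0)"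
  using coeff_monomial[of r "[]"] by (simp add: word_Nil)

lemma coeff_0: "coeff 0 w = 0"
  using coeff_hom[of 0 w] by (simp add: hom_0)

lemma coeff_1: "coeff 1 u = (if u = [] then 1 else 0)"
  using coeff_hom[of 1 u] by (simp add: hom_1)

lemma coeff_word: "coeff (word w) u = (if u = w then 1 else 0)"
  using coeff_monomial[of 1 w u] by (simp add: hom_1)

lemma coeff_uminus: "coeff (- s) w = - coeff s w"
  using coeff_add[of "- s" s w] by (simp add: coeff_0 eq_neg_iff_add_eq_0)

lemma coeff_sum: "coeff (sum f A) w = (\<Sum>a\<in>A. coeff (f a) w)"
  by (induction A rule: infinite_finite_induct) (auto simp: coeff_0 coeff_add)

lemma coeff_hom_mult: "coeff (\<iota> r * s) w = r * coeff s w"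
proof -
  have "coeff (\<iota> r * s) = (\<lambda>w. r * coeff s w)"
  proof (rule coeff_eqI[OF finite_coeff[of s]])
    have "\<iota> r * s = \<iota> r * (\<Sum>w\<in>{w. coeff s w \<noteq> 0}. \<iota> (coeff s w) * word w)"
      by (rule arg_cong[OF sum_coeff])
    then show "\<iota> r * s = (\<Sum>w\<in>{w. coeff s w \<noteq> 0}. \<iota> (r * coeff s w) * word w)"
      by (simp add: sum_distrib_left hom_mult mult.assoc)
  qed auto
  then show ?thesis by simp
qed

lemma monomial_induct:
  assumes "P 0" "\<And>s t. P s \<Longrightarrow> P t \<Longrightarrow> P (s + t)" "\<And>r w. P (\<iota> r * word w)"
  shows "P s"
proof -
  have "P (\<Sum>w\<in>A. \<iota> (coeff s w) * word w)" for A
    by (induction A rule: infinite_finite_induct) (auto intro: assms)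
  then show ?thesis by (subst sum_coeff)
qed

text \<open>Both sides are additive in \<open>t\<close>, so monomials suffice; there the commutation
  rule yields one term with the word prolonged by \<open>x\<close> and one with the word
  unchanged.\<close>

lemma coeff_var_mult:
  "coeff (var x * t) u =
     (case u of [] \<Rightarrow> 0 | y # w \<Rightarrow> if y = x then \<sigma> x (coeff t w) else 0) + \<delta> x (coeff t u)"
proof (induction t rule: monomial_induct)
  case 1
  then show ?case
    by (simp add: coeff_0 der_0 ring_automorphismD(4)[OF automorphism] split: list.split)
next
  case (2 s t)
  then show ?case
    by (simp add: distrib_left coeff_add der_add ring_automorphismD(1)[OF automorphism] split: list.split)
next
  case (3 r w)
  have "var x * (\<iota> r * word w) = \<iota> (\<sigma> x r) * word (x # w) + \<iota> (\<delta> x r) * word w"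
    by (simp add: mult.assoc[symmetric] var_hom word_Cons distrib_right)
  then show ?case
    by (auto simp: coeff_add coeff_monomial der_0 ring_automorphismD(4)[OF automorphism] split: list.split)
qed

section \<open>Degrees and leading coefficients of products\<close>

lemma automorphism_word: "ring_automorphism (foldr \<sigma> v)"
proof (induction v)
  case Nil
  then show ?case using ring_automorphism_id by (simp add: id_def)
next
  case (Cons x v)
  then show ?case using ring_automorphism_comp[OF automorphism[of x] Cons] by (simp add: o_def)
qed

text \<open>For leading forms no ordering of the variables is needed: a word of length \<open>m + n\<close> splits in
  only one way into a word of length \<open>m\<close> and a word of length \<open>n\<close>.\<close>

definition degree_le :: "nat \<Rightarrow> 's \<Rightarrow> bool" where
  "degree_le n s \<longleftrightarrow> (\<forall>w. n < length w \<longrightarrow> coeff s w = 0)"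

text \<open>Prefixing a letter raises the degree bound by one, while the derivation term does not.
  At the new top length that term involves a coefficient beyond the old bound, so only the twist by
  the automorphisms survives.\<close>

lemma coeff_word_mult:
  assumes "degree_le n t"
  shows "degree_le (length v + n) (word v * t)"
    and "length u = length v \<Longrightarrow> length w = n \<Longrightarrow>
      coeff (word v * t) (u @ w) = (if u = v then foldr \<sigma> v (coeff t w) else 0)"
proof -
  have "degree_le (length v + n) (word v * t) \<and> (\<forall>u w. length u = length v \<longrightarrow> length w = n \<longrightarrow>
      coeff (word v * t) (u @ w) = (if u = v then foldr \<sigma> v (coeff t w) else 0))"
  proof (induction v)
    case Nil
    then show ?case using assms by (simp add: word_Nil)
  next
    case (Cons x v)
    let ?t = "word v * t"
    have e: "word (x # v) * t = var x * ?t" by (simp add: word_Cons mult.assoc)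
    have d: "\<And>w. length v + n < length w \<Longrightarrow> coeff ?t w = 0"
      using Cons.IH by (auto simp: degree_le_def)
    show ?case
      unfolding e degree_le_def coeff_var_mult
    proof (intro conjI allI impI)
      fix w :: "'x list" assume "length (x # v) + n < length w"
      then show "(case w of [] \<Rightarrow> 0 | y # w \<Rightarrow> if y = x then \<sigma> x (coeff ?t w) else 0) + \<delta> x (coeff ?t w) = 0"
        by (cases w) (auto simp: d der_0 ring_automorphismD(4)[OF automorphism])
    next
      fix u w :: "'x list" assume u: "length u = length (x # v)" and w: "length w = n"
      then obtain y u' where "u = y # u'" "length u' = length v" by (cases u) auto
      then show "(case u @ w of [] \<Rightarrow> 0 | y # w \<Rightarrow> if y = x then \<sigma> x (coeff ?t w) else 0) +
          \<delta> x (coeff ?t (u @ w)) = (if u = x # v then foldr \<sigma> (x # v) (coeff t w) else 0)"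
        using w Cons.IH by (auto simp: d der_0 ring_automorphismD(4)[OF automorphism])
    qed
  qed
  then show "degree_le (length v + n) (word v * t)"
    and "length u = length v \<Longrightarrow> length w = n \<Longrightarrow>
      coeff (word v * t) (u @ w) = (if u = v then foldr \<sigma> v (coeff t w) else 0)"
    by blast+
qed

lemma coeff_mult_conv:
  "coeff (s * t) z = (\<Sum>v\<in>{v. coeff s v \<noteq> 0}. coeff s v * coeff (word v * t) z)"
proof -
  have "s * t = (\<Sum>v\<in>{v. coeff s v \<noteq> 0}. \<iota> (coeff s v) * (word v * t))"
    using arg_cong[OF sum_coeff[of s], of "\<lambda>s. s * t"] by (simp add: sum_distrib_right mult.assoc)
  then show ?thesis by (simp add: coeff_sum coeff_hom_mult)
qed

text \<open>Words of \<open>s\<close> shorter than \<open>m\<close> contribute only below length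
  \<open>m + n\<close>; among those of length \<open>m\<close>, only \<open>u\<close> is a prefix of
  \<open>u @ w\<close>.\<close>

lemma coeff_mult:
  assumes s: "degree_le m s" and t: "degree_le n t"
  shows degree_le_mult: "degree_le (m + n) (s * t)"
    and coeff_mult_top: "length u = m \<Longrightarrow> length w = n \<Longrightarrow>
      coeff (s * t) (u @ w) = coeff s u * foldr \<sigma> u (coeff t w)"
proof -
  have len: "length v \<le> m" if "coeff s v \<noteq> 0" for v
    using s that by (meson degree_le_def not_le)
  have z: "coeff (word v * t) z = 0" if "length v + n < length z" for v z
    using coeff_word_mult(1)[OF t, of v] that by (auto simp: degree_le_def)
  show "degree_le (m + n) (s * t)"
    unfolding degree_le_def coeff_mult_conv[of s t]
  proof (intro allI impI sum.neutral ballI)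
    fix z v :: "'x list" assume "m + n < length z" "v \<in> {v. coeff s v \<noteq> 0}"
    then have "length v + n < length z" using len[of v] by simp
    then show "coeff s v * coeff (word v * t) z = 0" by (simp add: z)
  qed
  assume u: "length u = m" and w: "length w = n"
  have "coeff (s * t) (u @ w) =
      (\<Sum>v\<in>{v. coeff s v \<noteq> 0}. if v = u then coeff s u * foldr \<sigma> u (coeff t w) else 0)"
    unfolding coeff_mult_conv[of s t]
  proof (rule sum.cong[OF refl])
    fix v assume v: "v \<in> {v. coeff s v \<noteq> 0}"
    show "coeff s v * coeff (word v * t) (u @ w) =
        (if v = u then coeff s u * foldr \<sigma> u (coeff t w) else 0)"
    proof (cases "length v = m")
      case True
      then show ?thesis using coeff_word_mult(2)[OF t, of u v w] u w by auto
    next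
      case False
      then have "length v < m" using len v by force
      then show ?thesis using z[of v "u @ w"] u w by auto
    qed
  qed
  also have "\<dots> = coeff s u * foldr \<sigma> u (coeff t w)"
    using finite_coeff[of s] by (simp add: sum.delta)
  finally show "coeff (s * t) (u @ w) = coeff s u * foldr \<sigma> u (coeff t w)" .
qed

section \<open>Ideals of leading coefficients\<close>

lemma exists_top_coeff:
  assumes "s \<noteq> 0"
  shows "\<exists>v. coeff s v \<noteq> 0 \<and> degree_le (length v) s"
proof -
  let ?A = "{w. coeff s w \<noteq> 0}"
  have ne: "?A \<noteq> {}"
  proof
    assume e: "?A = {}"
    have "s = 0" by (subst sum_coeff) (simp only: e sum.empty)
    then show False using assms by simp
  qed
  have "\<exists>v\<in>?A. \<forall>w\<in>?A. length w \<le> length v"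
    using Max_in[of "length ` ?A"] Max_ge[of "length ` ?A"] finite_coeff[of s] ne
    by (smt (verit, best) finite_imageI image_iff image_is_empty)
  then show ?thesis by (force simp: degree_le_def)
qed

text \<open>Only an upper bound on the degree is imposed, so that 0 is included and sums stay in the
  set when top terms cancel. Other words of the same length may occur in \<open>f\<close>.\<close>

definition lead :: "'s set \<Rightarrow> 'x list \<Rightarrow> 'r set" where
  "lead J w = {coeff f w | f. f \<in> J \<and> degree_le (length w) f}"

lemma leadI: "f \<in> J \<Longrightarrow> degree_le (length w) f \<Longrightarrow> coeff f w \<in> lead J w"
  by (auto simp: lead_def)

text \<open>Multiplying by \<open>word v\<close> on the right prolongs the top word and keeps its
  coefficient, since automorphisms fix 1; on the left it also twists the coefficient by
  \<open>foldr \<sigma> v\<close>.\<close>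

lemma lead_append:
  assumes J: "two_sided_ideal J"
  shows "lead J w \<subseteq> lead J (w @ v)" "foldr \<sigma> v ` lead J w \<subseteq> lead J (v @ w)"
proof -
  have dv: "degree_le (length v) (word v)" for v by (auto simp: degree_le_def coeff_word)
  show "lead J w \<subseteq> lead J (w @ v)"
  proof
    fix a assume "a \<in> lead J w"
    then obtain f where f: "a = coeff f w" "f \<in> J" "degree_le (length w) f" by (auto simp: lead_def)
    have "coeff (f * word v) (w @ v) = a"
      using coeff_mult_top[OF f(3) dv[of v]] f(1)
      by (simp add: coeff_word ring_automorphismD(3)[OF automorphism_word])
    moreover have "coeff (f * word v) (w @ v) \<in> lead J (w @ v)"
      using f degree_le_mult[OF f(3) dv[of v]] two_sided_idealD(2)[OF J] by (intro leadI) auto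
    ultimately show "a \<in> lead J (w @ v)" by simp
  qed
  show "foldr \<sigma> v ` lead J w \<subseteq> lead J (v @ w)"
  proof
    fix a assume "a \<in> foldr \<sigma> v ` lead J w"
    then obtain f where f: "a = foldr \<sigma> v (coeff f w)" "f \<in> J" "degree_le (length w) f"
      by (auto simp: lead_def)
    have "coeff (word v * f) (v @ w) = a"
      using coeff_mult_top[OF dv[of v] f(3)] f(1) by (simp add: coeff_word)
    moreover have "coeff (word v * f) (v @ w) \<in> lead J (v @ w)"
      using f degree_le_mult[OF dv[of v] f(3)] two_sided_idealD(3)[OF J] by (intro leadI) auto
    ultimately show "a \<in> lead J (v @ w)" by simp
  qed
qed

lemma two_sided_ideal_lead:
  assumes J: "two_sided_ideal J"
  shows "two_sided_ideal (lead J w)"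
proof -
  note L = left_idealD[OF two_sided_idealD(1)[OF J]]
  have d0: "degree_le 0 (\<iota> r)" for r by (auto simp: degree_le_def coeff_hom)
  show ?thesis
    unfolding two_sided_ideal_def left_ideal_def
  proof (intro conjI ballI allI)
    show "0 \<in> lead J w" using leadI[of 0 J w] L(1) by (simp add: coeff_0 degree_le_def)
    fix a assume "a \<in> lead J w"
    then obtain f where f: "a = coeff f w" "f \<in> J" "degree_le (length w) f" by (auto simp: lead_def)
    show "- a \<in> lead J w"
      using leadI[of "- f" J w] f L(3) by (simp add: coeff_uminus degree_le_def)
    show "r * a \<in> lead J w" for r
      using leadI[of "\<iota> r * f" J w] f L(4) by (simp add: coeff_hom_mult degree_le_def)
    show "a * r \<in> lead J w" for r
    proof -
      \<comment> \<open>Right multiplication by \<open>\<iota> q\<close> multiplies the coefficient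
        at \<open>w\<close> by \<open>foldr \<sigma> w q\<close>, so surjectivity of the twist is
        needed to reach every \<open>r\<close>.\<close>
      obtain q where q: "r = foldr \<sigma> w q"
        using ring_automorphismD(7)[OF automorphism_word[of w]] by (metis bij_pointE)
      have "coeff (f * \<iota> q) (w @ []) = a * r"
        using coeff_mult_top[OF f(3) d0[of q], of w "[]"] f(1) q by (simp add: coeff_hom)
      moreover have "coeff (f * \<iota> q) w \<in> lead J w"
        using f degree_le_mult[OF f(3) d0[of q]] two_sided_idealD(2)[OF J] by (intro leadI) auto
      ultimately show ?thesis by simp
    qed
    fix b assume "b \<in> lead J w"
    then obtain g where g: "b = coeff g w" "g \<in> J" "degree_le (length w) g" by (auto simp: lead_def)
    show "a + b \<in> lead J w"
      using leadI[of "f + g" J w] f g L(2) by (simp add: coeff_add degree_le_def)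
  qed
qed

end

text \<open>Maximality is stated through double annihilators because the chain condition is an ascending
  one, whereas the annihilators themselves shrink as the ideals grow.\<close>

lemma double_annihilator_maximal_Int:
  fixes I K :: "'a::ring_1 set"
  assumes sp: "semiprime_ring TYPE('a)" and I: "two_sided_ideal I" and K: "two_sided_ideal K"
    and eq: "left_annihilator (left_annihilator K) = left_annihilator (left_annihilator I)"
    and d: "d \<in> K" "\<And>i. i \<in> I \<Longrightarrow> d * i = 0"
  shows "d = 0"
proof -
  have "d * t = 0" if "t \<in> left_annihilator K" for t
  proof -
    have "\<forall>i\<in>K. t * i = 0" using that by (simp add: left_annihilator_def)
    then show ?thesis using semiprime_annihilators_eq[OF sp K] d(1) by blast
  qed
  then have dd: "d \<in> left_annihilator (left_annihilator I)"
    unfolding eq[symmetric] by (simp add: left_annihilator_def)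
  \<comment> \<open>Since \<open>d\<close> annihilates \<open>I\<close>, so does
    \<open>r * d\<close>; and \<open>d\<close> annihilates the whole left annihilator of
    \<open>I\<close>.\<close>
  have "d * r * d = 0" for r
  proof -
    have "r * d \<in> left_annihilator I" using d(2) by (simp add: left_annihilator_def mult.assoc)
    then show ?thesis using dd by (simp add: left_annihilator_def mult.assoc)
  qed
  then show ?thesis by (rule semiprime_square_zero[OF sp])
qed

lemma left_annihilator_antimono: "S \<subseteq> T \<Longrightarrow> left_annihilator T \<subseteq> left_annihilator S"
  by (auto simp: left_annihilator_def)

context skew_extension
begin

text \<open>Maximising over all twists by ring automorphisms makes the choice of \<open>w\<close> insensitive to the
  twist by \<open>foldr \<sigma> v\<close>.\<close>

lemma exists_stable_lead:
  assumes sp: "semiprime_ring TYPE('r)" and acc: "acc_left_annihilators TYPE('r)"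
    and J: "two_sided_ideal J" "J \<noteq> {0}"
  shows "\<exists>w. w \<noteq> [] \<and> lead J w \<noteq> {0} \<and>
    (\<forall>v. \<forall>d\<in>lead J (v @ w). (\<forall>i\<in>lead J w. d * foldr \<sigma> v i = 0) \<longrightarrow> d = 0)"
proof -
  define C where "C = {left_annihilator (left_annihilator (\<tau> ` lead J w)) | \<tau> w.
    ring_automorphism \<tau> \<and> w \<noteq> [] \<and> lead J w \<noteq> {0}}"
  obtain f where f: "f \<in> J" "f \<noteq> 0"
    using left_ideal_nonzero[OF two_sided_idealD(1)[OF J(1)] J(2)] by blast
  obtain u where u: "coeff f u \<noteq> 0" "degree_le (length u) f"
    using exists_top_coeff[OF f(2)] by blast
  \<comment> \<open>The set of variables is a type, hence nonempty. Appending a letter makes the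
    word nonempty even if \<open>f\<close> is a constant.\<close>
  obtain x :: 'x where True by blast
  have "coeff f u \<in> lead J (u @ [x])"
    using leadI[OF f(1) u(2)] lead_append(1)[OF J(1)] by blast
  then have "lead J (u @ [x]) \<noteq> {0}" using u(1) by blast
  then have "C \<noteq> {}" unfolding C_def using ring_automorphism_id by blast
  then have "\<exists>M\<in>C. \<forall>A\<in>C. M \<subseteq> A \<longrightarrow> A = M"
    by (rule acc_left_annihilators_maximal[OF acc]) (auto simp: C_def)
  then obtain M where M: "M \<in> C" "\<And>A. A \<in> C \<Longrightarrow> M \<subseteq> A \<Longrightarrow> A = M" by blast
  then obtain \<tau> w where \<tau>: "ring_automorphism \<tau>" and w: "w \<noteq> []" "lead J w \<noteq> {0}"
    and Mw: "M = left_annihilator (left_annihilator (\<tau> ` lead J w))"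
    unfolding C_def by blast
  have max: "\<And>\<rho> z. ring_automorphism \<rho> \<Longrightarrow> z \<noteq> [] \<Longrightarrow> lead J z \<noteq> {0} \<Longrightarrow>
      left_annihilator (left_annihilator (\<tau> ` lead J w)) \<subseteq> left_annihilator (left_annihilator (\<rho> ` lead J z))
      \<Longrightarrow> left_annihilator (left_annihilator (\<rho> ` lead J z)) = left_annihilator (left_annihilator (\<tau> ` lead J w))"
    unfolding Mw[symmetric] by (rule M(2)) (auto simp: C_def)
  have "d = 0" if d: "d \<in> lead J (v @ w)" "\<forall>i\<in>lead J w. d * foldr \<sigma> v i = 0" for v d
  proof -
    let ?s = "foldr \<sigma> v"
    \<comment> \<open>This twist undoes \<open>foldr \<sigma> v\<close> before applying
      \<open>\<tau>\<close>, so the image of \<open>lead J (v @ w)\<close> under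
      \<open>\<rho>\<close> contains that of \<open>lead J w\<close> under \<open>\<tau>\<close>,
      and maximality makes the double annihilators equal.\<close>
    define \<rho> where "\<rho> = \<tau> \<circ> inv ?s"
    have \<rho>: "ring_automorphism \<rho>"
      unfolding \<rho>_def by (intro ring_automorphism_comp \<tau> ring_automorphism_inv automorphism_word)
    have \<rho>s: "\<rho> (?s i) = \<tau> i" for i
      using ring_automorphismD(7)[OF automorphism_word[of v]] by (simp add: \<rho>_def bij_is_inj)
    have sub: "\<tau> ` lead J w \<subseteq> \<rho> ` lead J (v @ w)"
      using lead_append(2)[OF J(1), of v w] \<rho>s by (metis image_subset_iff imageI)
    have nz: "lead J (v @ w) \<noteq> {0}"
    proof -
      obtain i where "i \<in> lead J w" "i \<noteq> 0"
        using left_ideal_nonzero[OF two_sided_idealD(1)[OF two_sided_ideal_lead[OF J(1)]] w(2)] by blast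
      then have "?s i \<in> lead J (v @ w)" "?s i \<noteq> 0"
        using lead_append(2)[OF J(1)] ring_automorphismD(6)[OF automorphism_word] by blast+
      then show ?thesis by blast
    qed
    have eq: "left_annihilator (left_annihilator (\<rho> ` lead J (v @ w))) =
        left_annihilator (left_annihilator (\<tau> ` lead J w))"
      using w by (intro max \<rho> nz left_annihilator_antimono sub) auto
    have "\<rho> d * i = 0" if "i \<in> \<tau> ` lead J w" for i
      using that d(2) ring_automorphismD(2,4)[OF \<rho>] \<rho>s by (metis (no_types, lifting) imageE)
    then have "\<rho> d = 0"
      using double_annihilator_maximal_Int[OF sp two_sided_ideal_image[OF \<tau> two_sided_ideal_lead[OF J(1)]]
        two_sided_ideal_image[OF \<rho> two_sided_ideal_lead[OF J(1)]] eq] d(1) by blast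
    then show ?thesis using ring_automorphismD(6)[OF \<rho>] by blast
  qed
  then show ?thesis using w by blast
qed

section \<open>Vanishing of the Jacobson radical\<close>

lemma semiprimitive_extension:
  assumes sp: "semiprime_ring TYPE('r)" and goldie: "left_goldie TYPE('r)"
  shows "semiprimitive TYPE('s)"
proof (rule ccontr)
  define J where "J = jacobson_radical TYPE('s)"
  assume "\<not> semiprimitive TYPE('s)"
  then have J0: "J \<noteq> {0}" by (simp add: semiprimitive_def J_def)
  have J: "two_sided_ideal J"
    using left_ideal_jacobson_radical jacobson_radical_mult_right by (auto simp: two_sided_ideal_def J_def)
  note LJ = two_sided_idealD(1)[OF J]
  have acc: "acc_left_annihilators TYPE('r)" using goldie by (simp add: left_goldie_def)
  obtain w where w: "w \<noteq> []" "lead J w \<noteq> {0}"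
    and stable: "\<And>v d. d \<in> lead J (v @ w) \<Longrightarrow> (\<And>i. i \<in> lead J w \<Longrightarrow> d * foldr \<sigma> v i = 0) \<Longrightarrow> d = 0"
    using exists_stable_lead[OF sp acc J J0] by blast
  define I where "I = lead J w"
  have I: "two_sided_ideal I" unfolding I_def by (rule two_sided_ideal_lead[OF J])
  obtain c where c: "c \<in> I" "\<And>r. r \<in> I \<Longrightarrow> r * c = 0 \<Longrightarrow> r = 0"
    using goldie_exists_left_regular[OF sp goldie two_sided_idealD(1)[OF I]] by blast
  have c0: "c \<noteq> 0"
  proof
    assume "c = 0"
    then have "I \<subseteq> {0}" using c(2) by auto
    then show False using w(2) c(1) by (auto simp: I_def)
  qed
  obtain g where g: "g \<in> J" "degree_le (length w) g" "coeff g w = c"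
    using c(1) by (auto simp: I_def lead_def)
  \<comment> \<open>Adding 1 changes only the coefficient at the empty word, and \<open>w\<close> is
    nonempty.\<close>
  have g1: "degree_le (length w) (1 + g)" "coeff (1 + g) w = c"
    using g w(1) by (auto simp: degree_le_def coeff_add coeff_1)
  obtain h where h: "h * (1 + g) = 1"
    using jacobson_radical_left_inverse g(1) by (auto simp: J_def)
  have "h - 1 = - (h * g)" using h by (simp add: distrib_left algebra_simps)
  then have h1: "h - 1 \<in> J" using left_idealD(3,4)[OF LJ] g(1) by auto
  \<comment> \<open>As \<open>h\<close> is 1 plus an element of the radical, it has a left inverse
    itself, which allows cancelling it in \<open>h * \<iota> c = 0\<close> below.\<close>
  then obtain k where k: "k * h = 1" using jacobson_radical_left_inverse[of "h - 1"] by (auto simp: J_def)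
  have "h \<noteq> 0" using h by auto
  then obtain v where v: "coeff h v \<noteq> 0" "degree_le (length v) h" using exists_top_coeff by blast
  have "coeff (h * (1 + g)) (v @ w) = coeff h v * foldr \<sigma> v c"
    using coeff_mult_top[OF v(2) g1(1)] g1(2) by simp
  then have top: "coeff h v * foldr \<sigma> v c = 0" using h w(1) by (simp add: coeff_1)
  show False
  proof (cases "v = []")
    case True
    have "coeff h = coeff (\<iota> (coeff h []))"
      using v(2) True by (auto simp: degree_le_def coeff_hom fun_eq_iff)
    then have "h = \<iota> (coeff h [])" by (metis sum_coeff)
    then have "h * \<iota> c = 0" using top True hom_mult hom_0 by (metis foldr.simps(1) id_apply)
    then have "\<iota> c = 0" using k by (metis mult.assoc mult.left_neutral mult_zero_right)
    then show False using hom_eq_0 c0 by blast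
  next
    case False
    have "degree_le (length v) (h - 1)" "coeff (h - 1) v = coeff h v"
      using v(2) False by (auto simp: degree_le_def diff_conv_add_uminus coeff_add coeff_uminus coeff_1
          simp del: add_uminus_conv_diff)
    then have "coeff h v \<in> lead J v" using leadI[OF h1] by metis
    then have dv: "coeff h v \<in> lead J (v @ w)" using lead_append(1)[OF J] by blast
    let ?I = "foldr \<sigma> v ` I"
    note aut = ring_automorphismD[OF automorphism_word[of v]]
    have tI: "two_sided_ideal ?I" by (rule two_sided_ideal_image[OF automorphism_word I])
    \<comment> \<open>The product lies in the twisted ideal, hence equals
      \<open>foldr \<sigma> v j\<close> with \<open>j\<close> in \<open>I\<close>. By
      \<open>top\<close> the twist of \<open>j * c\<close> is 0, so the choice of \<open>c\<close>
      forces \<open>j = 0\<close>.\<close>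
    have "i * coeff h v = 0" if i: "i \<in> ?I" for i
    proof -
      have "i * coeff h v \<in> ?I" using two_sided_idealD(2)[OF tI i] .
      then obtain j where j: "i * coeff h v = foldr \<sigma> v j" "j \<in> I" by blast
      have "foldr \<sigma> v (j * c) = i * (coeff h v * foldr \<sigma> v c)"
        by (simp add: aut(2) j(1)[symmetric] mult.assoc)
      then have "j * c = 0" using top aut(6) by simp
      then have "j = 0" using c(2) j(2) by blast
      then show ?thesis using j(1) aut(4) by simp
    qed
    then have "\<forall>i\<in>?I. coeff h v * i = 0" using semiprime_annihilators_eq[OF sp tI] by blast
    then have "coeff h v = 0" by (intro stable[OF dv]) (auto simp: I_def)
    then show False using v(1) by simp
  qed
qed

end

theorem theoremA:
  fixes \<iota> :: "'r::ring_1 \<Rightarrow> 's::ring_1"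
    and var :: "'x \<Rightarrow> 's"
    and \<sigma> \<delta> :: "'x \<Rightarrow> 'r \<Rightarrow> 'r"
  assumes "semiprime_ring TYPE('r)"
    and "left_goldie TYPE('r)"
    and "\<And>x. ring_automorphism (\<sigma> x)"
    and "\<And>x. sigma_derivation (\<sigma> x) (\<delta> x)"
    and "free_skew_extension \<iota> var \<sigma> \<delta>"
  shows "semiprimitive TYPE('s)"
proof -
  interpret skew_extension \<iota> var \<sigma> \<delta> by unfold_locales (use assms in auto)
  show ?thesis using assms(1,2) by (rule semiprimitive_extension)
qed

end
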